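(* Let $\mathcal{C}$ be an idempotent Mal'cev clone on $\{0,1,2\}$ such that $\mathcal{C}$ contains no majority operation and does not preserve $\varphi=\{(0,1),(1,2),(2,0)\}$. Then $\mathcal{C}\equiv_{\mathrm{m}}\mathcal{Z}_2$.
   Context: A clone is idempotent if $f(x,\dots,x)\approx x$ for all its operations; Mal'cev if it contains $d$ with $d(y,x,x)\approx d(x,x,y)\approx y$; a majority operation $m$ satisfies $m(x,y,y)\approx m(y,x,y)\approx m(y,y,x)\approx y$. $\mathcal{Z}_2=\mathrm{Pol}(\{0,1\};\{(x,y,z,x-y+z\bmod 2)\},\{0\},\{1\})$ is the clone of idempotent affine operations modulo 2, where $\mathrm{Pol}(\Gamma)$ denotes the clone of operations preserving all relations of $\Gamma$. For an $n$-ary $f$ and $\sigma\colon[n]\to[r]$, $f_\sigma(x_1,\dots,x_r)=f(x_{\sigma(1)},\dots,x_{\sigma(n)})$; a minion homomorphism is an arity-preserving map $\xi$ between clones with $\xi(f_\sigma)=\xi(f)_\sigma$; $\mathcal{C}\equiv_{\mathrm{m}}\mathcal{D}$ means there are minion homomorphisms in both directions. *)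

theory Defs
  imports "HOL-Library.FuncSet"
begin

text \<open>Operations on a carrier A (a set of naturals) are represented as pairs (n, f)
  with arity n >= 1 and f an extensional function from n-tuples (lists of length n
  over A) to A.  A clone is a set of such pairs.\<close>

definition tuples :: "nat set \<Rightarrow> nat \<Rightarrow> nat list set" where
  "tuples A n = {xs. length xs = n \<and> set xs \<subseteq> A}"

definition ops :: "nat set \<Rightarrow> nat \<Rightarrow> (nat list \<Rightarrow> nat) set" where
  "ops A n = (tuples A n \<rightarrow>\<^sub>E A)"

definition proj :: "nat set \<Rightarrow> nat \<Rightarrow> nat \<Rightarrow> (nat list \<Rightarrow> nat)" where
  "proj A n i = restrict (\<lambda>xs. xs ! i) (tuples A n)"

definition compose :: "nat set \<Rightarrow> nat \<Rightarrow> (nat list \<Rightarrow> nat) \<Rightarrow> (nat list \<Rightarrow> nat) list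
    \<Rightarrow> (nat list \<Rightarrow> nat)" where
  "compose A m f gs = restrict (\<lambda>xs. f (map (\<lambda>g. g xs) gs)) (tuples A m)"

definition is_clone :: "nat set \<Rightarrow> (nat \<times> (nat list \<Rightarrow> nat)) set \<Rightarrow> bool" where
  "is_clone A C \<longleftrightarrow>
     (\<forall>(n, f) \<in> C. n \<ge> 1 \<and> f \<in> ops A n) \<and>
     (\<forall>n i. 1 \<le> n \<and> i < n \<longrightarrow> (n, proj A n i) \<in> C) \<and>
     (\<forall>n m f gs. (n, f) \<in> C \<and> m \<ge> 1 \<and> length gs = n \<and> (\<forall>g \<in> set gs. (m, g) \<in> C)
        \<longrightarrow> (m, compose A m f gs) \<in> C)"

definition minor :: "nat set \<Rightarrow> nat \<Rightarrow> nat \<Rightarrow> (nat \<Rightarrow> nat) \<Rightarrow> (nat list \<Rightarrow> nat)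
    \<Rightarrow> (nat list \<Rightarrow> nat)" where
  "minor A n r \<sigma> f = restrict (\<lambda>xs. f (map (\<lambda>i. xs ! \<sigma> i) [0..<n])) (tuples A r)"

definition minion_hom :: "nat set \<Rightarrow> (nat \<times> (nat list \<Rightarrow> nat)) set \<Rightarrow> nat set
    \<Rightarrow> (nat \<times> (nat list \<Rightarrow> nat)) set \<Rightarrow> (nat \<Rightarrow> (nat list \<Rightarrow> nat) \<Rightarrow> (nat list \<Rightarrow> nat)) \<Rightarrow> bool" where
  "minion_hom A C B D \<xi> \<longleftrightarrow>
     (\<forall>(n, f) \<in> C. (n, \<xi> n f) \<in> D) \<and>
     (\<forall>(n, f) \<in> C. \<forall>r \<sigma>. r \<ge> 1 \<and> (\<forall>i < n. \<sigma> i < r)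
        \<longrightarrow> \<xi> r (minor A n r \<sigma> f) = minor B n r \<sigma> (\<xi> n f))"

definition minion_equiv :: "nat set \<Rightarrow> (nat \<times> (nat list \<Rightarrow> nat)) set \<Rightarrow> nat set
    \<Rightarrow> (nat \<times> (nat list \<Rightarrow> nat)) set \<Rightarrow> bool" where
  "minion_equiv A C B D \<longleftrightarrow> (\<exists>\<xi>. minion_hom A C B D \<xi>) \<and> (\<exists>\<zeta>. minion_hom B D A C \<zeta>)"

definition idempotent_clone :: "nat set \<Rightarrow> (nat \<times> (nat list \<Rightarrow> nat)) set \<Rightarrow> bool" where
  "idempotent_clone A C \<longleftrightarrow> (\<forall>(n, f) \<in> C. \<forall>a \<in> A. f (replicate n a) = a)"

definition malcev_clone :: "nat set \<Rightarrow> (nat \<times> (nat list \<Rightarrow> nat)) set \<Rightarrow> bool" where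
  "malcev_clone A C \<longleftrightarrow> (\<exists>d. (3, d) \<in> C \<and>
     (\<forall>x \<in> A. \<forall>y \<in> A. d [y, x, x] = y \<and> d [x, x, y] = y))"

definition has_majority :: "nat set \<Rightarrow> (nat \<times> (nat list \<Rightarrow> nat)) set \<Rightarrow> bool" where
  "has_majority A C \<longleftrightarrow> (\<exists>m. (3, m) \<in> C \<and>
     (\<forall>x \<in> A. \<forall>y \<in> A. m [x, y, y] = y \<and> m [y, x, y] = y \<and> m [y, y, x] = y))"

definition preserves :: "nat \<Rightarrow> (nat list \<Rightarrow> nat) \<Rightarrow> nat \<Rightarrow> nat list set \<Rightarrow> bool" where
  "preserves n f k R \<longleftrightarrow>
     (\<forall>rs. length rs = n \<and> set rs \<subseteq> R \<longrightarrow> map (\<lambda>j. f (map (\<lambda>t. t ! j) rs)) [0..<k] \<in> R)"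

definition Pol :: "nat set \<Rightarrow> (nat \<times> nat list set) set \<Rightarrow> (nat \<times> (nat list \<Rightarrow> nat)) set" where
  "Pol A \<Gamma> = {(n, f). n \<ge> 1 \<and> f \<in> ops A n \<and> (\<forall>(k, R) \<in> \<Gamma>. preserves n f k R)}"

definition clone_preserves :: "(nat \<times> (nat list \<Rightarrow> nat)) set \<Rightarrow> nat \<Rightarrow> nat list set \<Rightarrow> bool" where
  "clone_preserves C k R \<longleftrightarrow> (\<forall>(n, f) \<in> C. preserves n f k R)"

definition affine2_rel :: "nat list set" where
  "affine2_rel = {[x, y, z, nat ((int x - int y + int z) mod 2)] | x y z. x \<in> {0,1} \<and> y \<in> {0,1} \<and> z \<in> {0,1}}"

definition Z2 :: "(nat \<times> (nat list \<Rightarrow> nat)) set" where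
  "Z2 = Pol {0, 1} {(4, affine2_rel), (1, {[0]}), (1, {[1]})}"

definition phi :: "nat list set" where
  "phi = {[0, 1], [1, 2], [2, 0]}"

end

theory Submission
  imports Defs
begin

text \<open>
  Let \<open>s\<^sub>c\<close> be the symmetric minority operation with value \<open>c\<close> on the permutations of \<open>(0, 1, 2)\<close>.
  The clone contains \<open>s\<^sub>c\<close> for some \<open>c\<close>: a Mal'cev operation can be turned into a minority
  operation unless it is \<open>x - y + z\<close> modulo 3, and a minority operation can be symmetrized unless it
  commutes with the cycle \<open>x \<mapsto> x + 1\<close>; both obstructions disappear when an operation that does not
  preserve \<open>\<phi>\<close> is composed in.

  From \<open>s\<^sub>c\<close> one obtains, for every odd \<open>n\<close>, the symmetric \<open>n\<close>-ary operation that cancels equal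
  arguments in pairs and then takes the remaining element, or \<open>c\<close> if all three elements remain. These
  operations are the image of a minion homomorphism from \<open>Z2\<close>.

  Conversely, the absence of a majority operation yields an invariant ternary relation containing
  \<open>(a\<^sub>1, t\<^sub>2, t\<^sub>3)\<close>, \<open>(t\<^sub>1, a\<^sub>2, t\<^sub>3)\<close>, \<open>(t\<^sub>1, t\<^sub>2, a\<^sub>3)\<close> but not \<open>(t\<^sub>1, t\<^sub>2, t\<^sub>3)\<close>. Invariance under \<open>s\<^sub>c\<close>
  forces it to be an affine equation modulo 2, so that reading the operations of the clone through
  \<open>t\<^sub>1\<close> and \<open>a\<^sub>1\<close> gives affine operations modulo 2.
\<close>

subsection \<open>Tuples, preservation and reflections\<close>

lemma tuples_iff_nth: "xs \<in> tuples A n \<longleftrightarrow> length xs = n \<and> (\<forall>i<n. xs ! i \<in> A)"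
  by (auto simp: tuples_def subset_iff in_set_conv_nth)

lemma tuples_nth: "xs \<in> tuples A n \<Longrightarrow> i < n \<Longrightarrow> xs ! i \<in> A"
  by (simp add: tuples_iff_nth)

lemma tuplesI: "length xs = n \<Longrightarrow> (\<And>i. i < n \<Longrightarrow> xs ! i \<in> A) \<Longrightarrow> xs \<in> tuples A n"
  by (simp add: tuples_iff_nth)

lemma length_tuple: "xs \<in> tuples A n \<Longrightarrow> length xs = n"
  by (simp add: tuples_def)

lemma tuples_3: "xs \<in> tuples A 3 \<longleftrightarrow> (\<exists>x\<in>A. \<exists>y\<in>A. \<exists>z\<in>A. xs = [x, y, z])"
  by (auto simp: tuples_def numeral_3_eq_3 length_Suc_conv)

lemma finite_tuples: "finite A \<Longrightarrow> finite (tuples A n)"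
  using finite_lists_length_eq[of A n] by (simp add: tuples_def conj_commute)

lemma replicate_in_tuples: "a \<in> A \<Longrightarrow> replicate n a \<in> tuples A n"
  by (auto simp: tuples_def)

lemma map_in_tuples: "xs \<in> tuples A n \<Longrightarrow> e \<in> A \<rightarrow> B \<Longrightarrow> map e xs \<in> tuples B n"
  by (auto simp: tuples_def)

lemma preserves_columns:
  assumes arity: "\<And>r. r \<in> R \<Longrightarrow> length r = k"
  shows "preserves n f k R \<longleftrightarrow>
    (\<forall>cs. length cs = k \<and> (\<forall>c\<in>set cs. length c = n) \<and> (\<forall>i<n. map (\<lambda>c. c ! i) cs \<in> R)
      \<longrightarrow> map f cs \<in> R)" (is "_ \<longleftrightarrow> ?columns")
proof
  assume pres: "preserves n f k R"
  show ?columns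
  proof (intro allI impI, elim conjE)
    fix cs assume cs: "length cs = k" "\<forall>c\<in>set cs. length c = n"
      and rows: "\<forall>i<n. map (\<lambda>c. c ! i) cs \<in> R"
    define rs where "rs = map (\<lambda>i. map (\<lambda>c. c ! i) cs) [0..<n]"
    have "length rs = n" "set rs \<subseteq> R" using rows by (auto simp: rs_def)
    then have "map (\<lambda>j. f (map (\<lambda>r. r ! j) rs)) [0..<k] \<in> R"
      using pres unfolding preserves_def by blast
    moreover have "map (\<lambda>r. r ! j) rs = cs ! j" if "j < k" for j
      using that cs by (auto simp: rs_def intro!: nth_equalityI)
    then have "map (\<lambda>j. f (map (\<lambda>r. r ! j) rs)) [0..<k] = map f cs"
      using cs(1) by (auto intro!: nth_equalityI)
    ultimately show "map f cs \<in> R" by simp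
  qed
next
  assume columns: ?columns
  show "preserves n f k R" unfolding preserves_def
  proof (intro allI impI, elim conjE)
    fix rs assume rs: "length rs = n" "set rs \<subseteq> R"
    define cs where "cs = map (\<lambda>j. map (\<lambda>r. r ! j) rs) [0..<k]"
    have "map (\<lambda>c. c ! i) cs = rs ! i" if "i < n" for i
      using that rs arity[of "rs ! i"] by (auto simp: cs_def subset_iff intro!: nth_equalityI)
    then have "\<forall>i<n. map (\<lambda>c. c ! i) cs \<in> R" using rs by (auto simp: subset_iff)
    moreover have "length cs = k" "\<forall>c\<in>set cs. length c = n" using rs(1) by (auto simp: cs_def)
    ultimately have "map f cs \<in> R" using columns by blast
    then show "map (\<lambda>j. f (map (\<lambda>r. r ! j) rs)) [0..<k] \<in> R" by (simp add: cs_def o_def)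
  qed
qed

definition reflection ::
    "nat set \<Rightarrow> (nat \<Rightarrow> nat) list \<Rightarrow> (nat list \<Rightarrow> nat) \<Rightarrow> nat \<Rightarrow> (nat list \<Rightarrow> nat) \<Rightarrow> nat list \<Rightarrow> nat" where
  "reflection B es h n f = restrict (\<lambda>xs. h (map (\<lambda>e. f (map e xs)) es)) (tuples B n)"

lemma reflection_minor:
  assumes es: "\<And>e. e \<in> set es \<Longrightarrow> e \<in> B \<rightarrow> A" and \<sigma>: "\<And>i. i < n \<Longrightarrow> \<sigma> i < r"
  shows "reflection B es h r (minor A n r \<sigma> f) = minor B n r \<sigma> (reflection B es h n f)"
proof
  fix xs
  show "reflection B es h r (minor A n r \<sigma> f) xs = minor B n r \<sigma> (reflection B es h n f) xs"
  proof (cases "xs \<in> tuples B r")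
    case True
    have "minor A n r \<sigma> f (map e xs) = f (map e (map (\<lambda>i. xs ! \<sigma> i) [0..<n]))" if "e \<in> set es" for e
      using map_in_tuples[OF True es[OF that]] length_tuple[OF True] \<sigma>
      by (auto simp: minor_def intro!: arg_cong[of _ _ f])
    moreover have "map (\<lambda>i. xs ! \<sigma> i) [0..<n] \<in> tuples B n"
      using tuples_nth[OF True] \<sigma> by (intro tuplesI) simp_all
    ultimately show ?thesis
      using True by (simp add: reflection_def minor_def[of B] cong: map_cong)
  qed (simp add: reflection_def minor_def)
qed

lemma minion_hom_reflection:
  assumes "\<And>e. e \<in> set es \<Longrightarrow> e \<in> B \<rightarrow> A" and "\<And>n f. (n, f) \<in> C \<Longrightarrow> (n, reflection B es h n f) \<in> D"
  shows "minion_hom A C B D (reflection B es h)"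
  unfolding minion_hom_def
proof (intro conjI ballI; clarify)
  fix n f assume "(n, f) \<in> C"
  then show "(n, reflection B es h n f) \<in> D" by (rule assms(2))
next
  fix n r :: nat and f \<sigma> assume "\<forall>i<n. \<sigma> i < r"
  then show "reflection B es h r (minor A n r \<sigma> f) = minor B n r \<sigma> (reflection B es h n f)"
    by (intro reflection_minor assms(1)) simp_all
qed

subsection \<open>Operations of a clone\<close>

type_synonym ternary_op = "nat \<Rightarrow> nat \<Rightarrow> nat \<Rightarrow> nat"

locale clone_on =
  fixes A :: "nat set" and C :: "(nat \<times> (nat list \<Rightarrow> nat)) set"
  assumes is_clone: "is_clone A C"
begin

text \<open>Operations of the clone are extensional; this predicate allows arbitrary representatives,
  so that term operations can be written as plain lambda abstractions.\<close>

definition in_clone :: "nat \<Rightarrow> (nat list \<Rightarrow> nat) \<Rightarrow> bool" where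
  "in_clone n f \<longleftrightarrow> (n, restrict f (tuples A n)) \<in> C"

lemma in_clone_cong:
  "in_clone n f \<Longrightarrow> (\<And>xs. xs \<in> tuples A n \<Longrightarrow> f xs = g xs) \<Longrightarrow> in_clone n g"
  unfolding in_clone_def by (metis restrict_ext)

lemma mem_arity_pos: "(n, f) \<in> C \<Longrightarrow> 1 \<le> n"
  and mem_ops: "(n, f) \<in> C \<Longrightarrow> f \<in> ops A n"
  using is_clone unfolding is_clone_def by auto

lemma in_clone_mem: "(n, f) \<in> C \<Longrightarrow> in_clone n f"
  using mem_ops[of n f] unfolding in_clone_def ops_def by (metis PiE_restrict)

lemma proj_mem: "i < n \<Longrightarrow> (n, proj A n i) \<in> C"
  using is_clone unfolding is_clone_def by auto

lemma in_clone_proj: "i < n \<Longrightarrow> in_clone n (\<lambda>xs. xs ! i)"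
  using proj_mem unfolding in_clone_def proj_def .

lemma in_clone_pos: "in_clone n f \<Longrightarrow> 1 \<le> n"
  unfolding in_clone_def by (rule mem_arity_pos)

lemma in_clone_closed:
  assumes "in_clone n f" "xs \<in> tuples A n"
  shows "f xs \<in> A"
proof -
  have "restrict f (tuples A n) \<in> ops A n" using assms(1) mem_ops unfolding in_clone_def by blast
  then show ?thesis using assms(2) unfolding ops_def by (metis PiE_mem restrict_apply')
qed

lemma in_clone_compose:
  assumes f: "in_clone k f" and n: "1 \<le> n"
    and gs: "length gs = k" "\<And>g. g \<in> set gs \<Longrightarrow> in_clone n g"
  shows "in_clone n (\<lambda>xs. f (map (\<lambda>g. g xs) gs))"
proof -
  let ?gs = "map (\<lambda>g. restrict g (tuples A n)) gs"
  have "(n, compose A n (restrict f (tuples A k)) ?gs) \<in> C"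
    using is_clone f n gs unfolding is_clone_def in_clone_def by force
  moreover have "compose A n (restrict f (tuples A k)) ?gs
      = restrict (\<lambda>xs. f (map (\<lambda>g. g xs) gs)) (tuples A n)"
  proof (unfold compose_def, rule restrict_ext)
    fix xs assume xs: "xs \<in> tuples A n"
    then have "map (\<lambda>g. g xs) gs \<in> tuples A k"
      using gs in_clone_closed[OF gs(2) xs] by (auto simp: tuples_def)
    with xs show "restrict f (tuples A k) (map (\<lambda>g. g xs) ?gs) = f (map (\<lambda>g. g xs) gs)"
      by (simp add: o_def)
  qed
  ultimately show ?thesis unfolding in_clone_def by simp
qed

lemma in_clone_minor:
  assumes f: "in_clone k f" and "is": "length is = k" "set is \<subseteq> {..<n}"
  shows "in_clone n (\<lambda>xs. f (map ((!) xs) is))"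
proof -
  have "is \<noteq> []" using in_clone_pos[OF f] "is"(1) by auto
  then have "1 \<le> n" using "is"(2) by (cases "is") auto
  then show ?thesis
    using in_clone_compose[OF f, of n "map (\<lambda>i xs. xs ! i) is"] "is" in_clone_proj
    by (auto simp: o_def subset_iff)
qed

definition ternary :: "ternary_op \<Rightarrow> bool" where
  "ternary f \<longleftrightarrow> in_clone 3 (\<lambda>xs. f (xs ! 0) (xs ! 1) (xs ! 2))"

lemma ternary_iff: "ternary (\<lambda>x y z. f [x, y, z]) \<longleftrightarrow> in_clone 3 f"
  unfolding ternary_def by (rule iffI; erule in_clone_cong) (auto simp: tuples_3)

lemma ternary_proj:
  "ternary (\<lambda>x y z. x)" "ternary (\<lambda>x y z. y)" "ternary (\<lambda>x y z. z)"
  unfolding ternary_def by (rule in_clone_proj; simp)+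

lemma ternary_apply:
  assumes "ternary f" "in_clone n g" "in_clone n h" "in_clone n k"
  shows "in_clone n (\<lambda>xs. f (g xs) (h xs) (k xs))"
  using in_clone_compose[OF assms(1)[unfolded ternary_def] in_clone_pos[OF assms(2)], of "[g, h, k]"]
    assms by auto

lemma ternary_compose:
  assumes "ternary f" "ternary g" "ternary h" "ternary k"
  shows "ternary (\<lambda>x y z. f (g x y z) (h x y z) (k x y z))"
  using ternary_apply[of f 3] assms unfolding ternary_def by simp

lemma ternary_cong:
  assumes "ternary f" "\<And>x y z. x \<in> A \<Longrightarrow> y \<in> A \<Longrightarrow> z \<in> A \<Longrightarrow> f x y z = g x y z"
  shows "ternary g"
  using assms(1) unfolding ternary_def
  by (rule in_clone_cong) (auto simp: assms(2) tuples_3)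

lemma ternary_closed: "ternary f \<Longrightarrow> x \<in> A \<Longrightarrow> y \<in> A \<Longrightarrow> z \<in> A \<Longrightarrow> f x y z \<in> A"
  unfolding ternary_def
  using in_clone_closed[of 3 "\<lambda>xs. f (xs ! 0) (xs ! 1) (xs ! 2)" "[x, y, z]"]
  by (auto simp: tuples_3)

end

locale idempotent_clone_on = clone_on +
  assumes idempotent: "idempotent_clone A C"
begin

lemma mem_idempotent: "(n, f) \<in> C \<Longrightarrow> a \<in> A \<Longrightarrow> f (replicate n a) = a"
  using idempotent unfolding idempotent_clone_def by blast

lemma ternary_idempotent:
  assumes "ternary f" "x \<in> A"
  shows "f x x x = x"
  using mem_idempotent[OF assms(1)[unfolded ternary_def in_clone_def] assms(2)]
    replicate_in_tuples[OF assms(2), of 3]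
  by simp

end

subsection \<open>From a Mal'cev operation to a minority operation\<close>

text \<open>On a two-element set, \<open>improve\<close> turns every Mal'cev operation into the minority operation. If
  \<open>d y x y = x\<close>, then \<open>twist d x y x = y\<close>, so that \<open>twist\<close> carries minority behaviour at \<open>y\<close> over to the
  other elements.\<close>

definition improve :: "ternary_op \<Rightarrow> ternary_op" where
  "improve d x y z = d (d x y z) (d x (d x y z) z) y"

definition twist :: "ternary_op \<Rightarrow> ternary_op" where
  "twist d x y z = d x (d y x y) (d y x z)"

context clone_on
begin

definition malcev_op :: "ternary_op \<Rightarrow> bool" where
  "malcev_op d \<longleftrightarrow> ternary d \<and> (\<forall>x\<in>A. \<forall>y\<in>A. d y x x = y \<and> d x x y = y)"

lemma malcev_opD:
  assumes "malcev_op d"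
  shows "ternary d" "x \<in> A \<Longrightarrow> y \<in> A \<Longrightarrow> d y x x = y" "x \<in> A \<Longrightarrow> y \<in> A \<Longrightarrow> d x x y = y"
  using assms unfolding malcev_op_def by blast+

lemma malcev_op_exists:
  assumes "malcev_clone A C"
  obtains d where "malcev_op d"
proof -
  obtain d where d: "(3, d) \<in> C" "\<forall>x\<in>A. \<forall>y\<in>A. d [y, x, x] = y \<and> d [x, x, y] = y"
    using assms unfolding malcev_clone_def by blast
  have "malcev_op (\<lambda>x y z. d [x, y, z])"
    unfolding malcev_op_def ternary_iff using d in_clone_mem by blast
  then show ?thesis by (rule that)
qed

definition minority_at :: "ternary_op \<Rightarrow> nat \<Rightarrow> bool" where
  "minority_at d x \<longleftrightarrow> (\<forall>y\<in>A. d x y x = y)"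

definition is_minority :: "ternary_op \<Rightarrow> bool" where
  "is_minority m \<longleftrightarrow> malcev_op m \<and> (\<forall>x\<in>A. minority_at m x)"

lemma is_minorityI:
  assumes "ternary m"
    and "\<And>x y. x \<in> A \<Longrightarrow> y \<in> A \<Longrightarrow> m y x x = y \<and> m x x y = y \<and> m x y x = y"
  shows "is_minority m"
  using assms unfolding is_minority_def malcev_op_def minority_at_def by blast

lemma is_minorityD:
  assumes "is_minority m"
  shows "ternary m" "x \<in> A \<Longrightarrow> y \<in> A \<Longrightarrow> m y x x = y"
    "x \<in> A \<Longrightarrow> y \<in> A \<Longrightarrow> m x x y = y" "x \<in> A \<Longrightarrow> y \<in> A \<Longrightarrow> m x y x = y"
  using assms unfolding is_minority_def malcev_op_def minority_at_def by blast+

lemma malcev_improve: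
  assumes "malcev_op d" shows "malcev_op (improve d)"
proof -
  note d = malcev_opD[OF assms]
  have "ternary (improve d)" unfolding improve_def by (intro ternary_compose[OF d(1)] ternary_proj)
  then show ?thesis using d(2,3) by (simp add: malcev_op_def improve_def)
qed

lemma malcev_twist:
  assumes "malcev_op d" shows "malcev_op (twist d)"
proof -
  note d = malcev_opD[OF assms]
  have "ternary (twist d)" unfolding twist_def by (intro ternary_compose[OF d(1)] ternary_proj)
  then show ?thesis using d(2,3) ternary_closed[OF d(1)] by (simp add: malcev_op_def twist_def)
qed

lemma improve_eq:
  assumes d: "malcev_op d" and xy: "x \<in> A" "y \<in> A"
    and val: "d x y x \<in> {x, y} \<or> d x (d x y x) x = d x y x"
  shows "improve d x y x = y"
proof -
  note d = malcev_opD[OF d]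
  have "d x y x \<in> A" using ternary_closed[OF d(1)] xy by blast
  with val show ?thesis unfolding improve_def using d(2,3) xy by auto
qed

end

locale idempotent_clone_three = idempotent_clone_on +
  assumes carrier: "A = {0, 1, 2}"
begin

lemma three_elements_exhaust:
  assumes "distinct [x, y, z]" "x \<in> A" "y \<in> A" "z \<in> A"
  shows "A = {x, y, z}"
  using assms unfolding carrier by auto

lemma third_element:
  obtains z where "z \<in> A" "z \<noteq> x" "z \<noteq> y"
proof -
  have "\<exists>z\<in>A. z \<noteq> x \<and> z \<noteq> y" unfolding carrier by auto
  then show ?thesis using that by blast
qed

text \<open>Swapping at every point is what the affine operation \<open>x - y + z\<close> modulo 3 does.\<close>

definition swaps_at :: "ternary_op \<Rightarrow> nat \<Rightarrow> bool" where
  "swaps_at d x \<longleftrightarrow> (\<forall>y\<in>A - {x}. d x y x \<notin> {x, y})"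

abbreviation "improve_twice d \<equiv> improve (improve d)"

lemma minority_at_improve_twice:
  assumes d: "malcev_op d" and x: "x \<in> A" "\<not> swaps_at d x"
  shows "minority_at (improve_twice d) x"
  unfolding minority_at_def
proof
  fix y assume y: "y \<in> A"
  obtain z where z: "z \<in> A" "z \<noteq> x" "d x z x \<in> {x, z}"
    using x(2) unfolding swaps_at_def by blast
  note d' = malcev_improve[OF d]
  have at_z: "improve d x z x = z" using improve_eq[OF d x(1) z(1)] z(3) by blast
  have at_x: "improve d x x x = x" using malcev_opD(2)[OF d' x(1) x(1)] .
  have "improve d x y x \<in> A" using ternary_closed[OF malcev_opD(1)[OF d']] x(1) y by blast
  moreover have "A = {x, y, z}" if "y \<notin> {x, z}"
    using that x(1) y z(1,2) by (intro three_elements_exhaust) auto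
  ultimately have "improve d x y x \<in> {x, y} \<or> improve d x (improve d x y x) x = improve d x y x"
    using at_x at_z by auto
  then show "improve_twice d x y x = y" by (rule improve_eq[OF d' x(1) y])
qed

definition spread :: "ternary_op \<Rightarrow> ternary_op" where
  "spread d = improve_twice (twist d)"

lemma malcev_spread: "malcev_op d \<Longrightarrow> malcev_op (spread d)"
  unfolding spread_def by (intro malcev_improve malcev_twist)

lemma minority_at_spread:
  assumes d: "malcev_op d" and x: "x \<in> A" "minority_at d x" and y: "y \<in> A" "y \<noteq> x"
  shows "minority_at (spread d) y"
proof -
  have "d x y x = y" using x(2) y(1) unfolding minority_at_def by blast
  then have "twist d y x y = x" using malcev_opD[OF d] x(1) y(1) by (simp add: twist_def)
  then have "\<not> swaps_at (twist d) y" using x(1) y unfolding swaps_at_def by auto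
  then show ?thesis
    unfolding spread_def using minority_at_improve_twice[OF malcev_twist[OF d] y(1)] by blast
qed

lemma minority_if_not_swaps_at:
  assumes d: "malcev_op d" and x: "x \<in> A" "\<not> swaps_at d x"
  shows "\<exists>m. is_minority m"
proof -
  define e where "e = improve_twice d"
  have e: "malcev_op e" "minority_at e x"
    unfolding e_def by (intro malcev_improve d) (rule minority_at_improve_twice[OF d x])
  have off_x: "minority_at (spread e) y" if "y \<in> A" "y \<noteq> x" for y
    using minority_at_spread[OF e(1) x(1) e(2) that] .
  have "minority_at (spread (spread e)) z" if z: "z \<in> A" for z
  proof -
    obtain y where "y \<in> A" "y \<noteq> x" "y \<noteq> z" using third_element .
    then show ?thesis using minority_at_spread[OF malcev_spread[OF e(1)]] off_x z by metis
  qed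
  then have "is_minority (spread (spread e))"
    unfolding is_minority_def using malcev_spread e(1) by blast
  then show ?thesis by blast
qed

definition affine_mod3 :: "ternary_op \<Rightarrow> bool" where
  "affine_mod3 d \<longleftrightarrow> (\<forall>x\<in>A. \<forall>y\<in>A. \<forall>z\<in>A. d x y z = (x + 2 * y + z) mod 3)"

lemma affine_mod3I:
  assumes "malcev_op d"
    and "\<And>x y. x \<in> A \<Longrightarrow> y \<in> A \<Longrightarrow> x \<noteq> y \<Longrightarrow> d x y x \<in> A - {x, y}"
    and "\<And>x y z. distinct [x, y, z] \<Longrightarrow> x \<in> A \<Longrightarrow> y \<in> A \<Longrightarrow> z \<in> A \<Longrightarrow> d x y z = y"
  shows "affine_mod3 d"
proof -
  have "d x y z = (x + 2 * y + z) mod 3" if xyz: "x \<in> A" "y \<in> A" "z \<in> A" for x y z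
  proof -
    consider (right) "y = z" | (left) "x = y" | (outer) "x = z" "x \<noteq> y"
      | (distinct) "distinct [x, y, z]" by auto
    then show ?thesis
    proof cases
      case right
      then show ?thesis using malcev_opD(2)[OF assms(1) xyz(3,1)] xyz unfolding carrier by auto
    next
      case left
      then show ?thesis using malcev_opD(3)[OF assms(1) xyz(1,3)] xyz unfolding carrier by auto
    next
      case outer
      then show ?thesis using assms(2)[OF xyz(1,2)] xyz unfolding carrier by auto
    next
      case distinct
      then show ?thesis using assms(3)[OF distinct xyz] xyz unfolding carrier by auto
    qed
  qed
  then show ?thesis unfolding affine_mod3_def by blast
qed

lemma minority_if_not_affine_mod3:
  assumes d: "malcev_op d" and not_affine: "\<not> affine_mod3 d"
  shows "\<exists>m. is_minority m"
proof (rule ccontr)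
  assume "\<not> ?thesis"
  then have swaps: "swaps_at e x" if "malcev_op e" "x \<in> A" for e x
    using minority_if_not_swaps_at that by blast
  have opposite: "e x y x \<in> A - {x, y}" if "malcev_op e" "x \<in> A" "y \<in> A" "x \<noteq> y" for e x y
    using swaps[of e x] that ternary_closed[OF malcev_opD(1)[OF that(1)]]
    unfolding swaps_at_def by auto
  have "d x y z = y" if xyz: "distinct [x, y, z]" "x \<in> A" "y \<in> A" "z \<in> A" for x y z
  proof -
    have A: "A = {x, y, z}" using three_elements_exhaust xyz .
    have "d z x z = y" using opposite[OF d, of z x] xyz unfolding A by auto
    then have "twist d x z x = d x y z" using malcev_opD[OF d] xyz by (simp add: twist_def)
    moreover have "twist d x z x = y"
      using opposite[OF malcev_twist[OF d], of x z] xyz unfolding A by auto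
    ultimately show ?thesis by simp
  qed
  then have "affine_mod3 d" using affine_mod3I[OF d opposite[OF d]] by blast
  with not_affine show False ..
qed

definition breaks_cycle :: "ternary_op \<Rightarrow> bool" where
  "breaks_cycle g \<longleftrightarrow> ternary g \<and> g 1 2 0 \<noteq> (g 0 1 2 + 1) mod 3"

text \<open>If \<open>d\<close> is \<open>x - y + z\<close> modulo 3, then the following term is \<open>w - x + w - h w z + h x y\<close>. It is a
  Mal'cev operation for every binary idempotent \<open>h\<close>, but can only equal \<open>w = x - y + z\<close> if \<open>h x y - x\<close>
  depends on \<open>x - y\<close> alone.\<close>

definition compare_shifts :: "ternary_op \<Rightarrow> (nat \<Rightarrow> nat \<Rightarrow> nat) \<Rightarrow> ternary_op" where
  "compare_shifts d h x y z = (let w = d x y z in d (d w x w) (h w z) (h x y))"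

lemma malcev_compare_shifts:
  assumes d: "malcev_op d" "affine_mod3 d" and h: "ternary (\<lambda>x y z. h x y)"
  shows "malcev_op (compare_shifts d h)"
proof -
  note td = malcev_opD(1)[OF d(1)]
  have "ternary (compare_shifts d h)"
    unfolding compare_shifts_def Let_def
    by (intro ternary_compose[OF td] ternary_compose[OF h _ _ ternary_proj(1)] ternary_proj)
  moreover have "compare_shifts d h y x x = y \<and> compare_shifts d h x x y = y"
    if xy: "x \<in> A" "y \<in> A" for x y
  proof
    show "compare_shifts d h y x x = y"
      using malcev_opD[OF d(1)] xy ternary_closed[OF h] by (simp add: compare_shifts_def)
    have "compare_shifts d h x x y = d (d y x y) y x"
      using malcev_opD[OF d(1)] xy ternary_idempotent[OF h] by (simp add: compare_shifts_def)
    also have "\<dots> = ((y + 2 * x + y) mod 3 + 2 * y + x) mod 3"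
      using d(2) xy ternary_closed[OF td, of y x y] unfolding affine_mod3_def by simp
    also have "\<dots> = y" using xy unfolding carrier by auto
    finally show "compare_shifts d h x x y = y" .
  qed
  ultimately show ?thesis unfolding malcev_op_def by blast
qed

lemma non_affine_malcev_exists:
  assumes d: "malcev_op d" and g: "breaks_cycle g"
  obtains e where "malcev_op e" "\<not> affine_mod3 e"
proof (cases "affine_mod3 d")
  case affine: True
  note td = malcev_opD(1)[OF d]
  have tg: "ternary g" and g_012: "g 1 2 0 \<noteq> (g 0 1 2 + 1) mod 3"
    using g unfolding breaks_cycle_def by blast+
  have d_eq: "d x y z = (x + 2 * y + z) mod 3" if "x \<in> A" "y \<in> A" "z \<in> A" for x y z
    using affine that unfolding affine_mod3_def by blast
  define e where "e = compare_shifts d (\<lambda>x y. g x y (d x y x))"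
  have malcev: "malcev_op e"
    unfolding e_def
    by (intro malcev_compare_shifts d affine ternary_compose[OF tg] ternary_compose[OF td] ternary_proj)
  have g_mem: "g 0 1 2 \<in> {0, 1, 2}" "g 1 2 0 \<in> {0, 1, 2}"
    using ternary_closed[OF tg] unfolding carrier by simp_all
  have "d 0 1 2 = 1" "d 0 1 0 = 2" "d 1 0 1 = 2" "d 1 2 1 = 0" using d_eq by (simp_all add: carrier)
  then have "e 0 1 2 = (2 + 2 * g 1 2 0 + g 0 1 2) mod 3"
    using g_mem d_eq[of 2 "g 1 2 0" "g 0 1 2"]
    by (simp add: e_def compare_shifts_def carrier del: One_nat_def)
  then have "e 0 1 2 \<noteq> 1" using g_mem g_012 by (elim insertE emptyE) simp_all
  moreover have "e 0 1 2 = 1" if "affine_mod3 e"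
    using that unfolding affine_mod3_def by (simp add: carrier)
  ultimately have "\<not> affine_mod3 e" by blast
  with malcev show ?thesis by (rule that)
qed (use d that in blast)

lemma minority_exists:
  assumes "malcev_op d" "breaks_cycle g"
  obtains m where "is_minority m"
  using non_affine_malcev_exists[OF assms] minority_if_not_affine_mod3 that by metis

end

subsection \<open>Symmetrizing a minority operation\<close>

definition sym_minority :: "nat \<Rightarrow> ternary_op" where
  "sym_minority c x y z = (if y = z then x else if x = y then z else if x = z then y else c)"

lemma sym_minority_simps [simp]:
  "sym_minority c x y y = x" "sym_minority c x x y = y" "sym_minority c x y x = y"
  by (simp_all add: sym_minority_def)

lemma sym_minority_commute:
  "sym_minority c x y z = sym_minority c y x z" "sym_minority c x y z = sym_minority c x z y"
  by (auto simp: sym_minority_def)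

lemma sym_minority_distinct: "distinct [x, y, z] \<Longrightarrow> sym_minority c x y z = c"
  by (simp add: sym_minority_def)

text \<open>A minority operation on \<open>{0, 1, 2}\<close> is determined by its values at the even and the odd
  permutations of \<open>(0, 1, 2)\<close>. Exchanging the last two arguments exchanges the two lists.\<close>

definition even_values :: "ternary_op \<Rightarrow> nat list" where
  "even_values m = [m 0 1 2, m 1 2 0, m 2 0 1]"

definition odd_values :: "ternary_op \<Rightarrow> nat list" where
  "odd_values m = [m 0 2 1, m 1 0 2, m 2 1 0]"

definition even_perms :: "nat list set" where
  "even_perms = {[0, 1, 2], [1, 2, 0], [2, 0, 1]}"

definition odd_perms :: "nat list set" where
  "odd_perms = {[0, 2, 1], [1, 0, 2], [2, 1, 0]}"

definition rotate_left :: "ternary_op \<Rightarrow> ternary_op" where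
  "rotate_left m x y z = m (m x y z) (m y z x) (m z x y)"

definition rotate_right :: "ternary_op \<Rightarrow> ternary_op" where
  "rotate_right m x y z = m (m x y z) (m z x y) (m y z x)"

definition transpose_even :: "ternary_op \<Rightarrow> ternary_op" where
  "transpose_even m x y z = (let w = m x y z in m (m x z w) (m y x w) (m z y w))"

definition transpose_odd :: "ternary_op \<Rightarrow> ternary_op" where
  "transpose_odd m x y z = (let w = m z y x in m (m x z w) (m y x w) (m z y w))"

context idempotent_clone_three
begin

lemma mem_carrier [simp]: "0 \<in> A" "Suc 0 \<in> A" "2 \<in> A"
  by (simp_all add: carrier)

lemma distinct_triple_cases:
  assumes "x \<in> A" "y \<in> A" "z \<in> A"
  shows "\<not> distinct [x, y, z] \<or> [x, y, z] \<in> even_perms \<or> [x, y, z] \<in> odd_perms"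
  using assms unfolding carrier even_perms_def odd_perms_def by auto

lemma is_minority_terms:
  assumes "is_minority m"
  shows "is_minority (rotate_left m)" "is_minority (rotate_right m)"
    "is_minority (transpose_even m)" "is_minority (transpose_odd m)"
    "is_minority (\<lambda>x y z. m x z y)" "is_minority (\<lambda>x y z. m y z x)" "is_minority (\<lambda>x y z. m z x y)"
  unfolding rotate_left_def rotate_right_def transpose_even_def transpose_odd_def Let_def
  by (rule is_minorityI; (intro ternary_compose[OF is_minorityD(1)[OF assms]] ternary_proj)?;
      simp add: is_minorityD[OF assms])+

lemma even_values_mem: "is_minority m \<Longrightarrow> even_values m = [a, b, c] \<Longrightarrow> a \<in> A \<and> b \<in> A \<and> c \<in> A"
  and odd_values_mem: "is_minority m \<Longrightarrow> odd_values m = [a, b, c] \<Longrightarrow> a \<in> A \<and> b \<in> A \<and> c \<in> A"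
  using ternary_closed[OF is_minorityD(1)] unfolding even_values_def odd_values_def by auto

lemma rotate_left_even_constant:
  assumes m: "is_minority m" and repeated: "\<not> distinct (even_values m)"
  shows "\<exists>k. even_values (rotate_left m) = [k, k, k]"
proof -
  obtain a b c where abc: "even_values m = [a, b, c]" by (simp add: even_values_def)
  then have "even_values (rotate_left m) = [m a b c, m b c a, m c a b]"
    by (simp add: even_values_def rotate_left_def)
  moreover have "a = b \<or> b = c \<or> a = c" using repeated abc by auto
  ultimately show ?thesis using is_minorityD[OF m] even_values_mem[OF m abc] by auto
qed

lemma transpose_odd_even_constant:
  assumes m: "is_minority m" and odd: "odd_values m \<in> odd_perms"
  shows "\<exists>k. even_values (transpose_odd m) = [k, k, k]"
  using odd is_minorityD[OF m] unfolding odd_perms_def odd_values_def even_values_def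
  by (elim insertE emptyE) (simp_all add: transpose_odd_def)

lemma minority_even_constant_if_not_even_perm:
  assumes m: "is_minority m" and "even_values m \<notin> even_perms"
  obtains m' k where "is_minority m'" "even_values m' = [k, k, k]"
proof -
  obtain a b c where "even_values m = [a, b, c]" by (simp add: even_values_def)
  then consider (repeated) "\<not> distinct (even_values m)" | (odd_perm) "even_values m \<in> odd_perms"
    using distinct_triple_cases even_values_mem[OF m] assms(2) by metis
  then show ?thesis
  proof cases
    case repeated
    then show ?thesis using rotate_left_even_constant[OF m] is_minority_terms[OF m] that by metis
  next
    case odd_perm
    let ?n = "\<lambda>x y z. m x z y"
    have n: "is_minority ?n" using is_minority_terms[OF m] by blast
    have "odd_values ?n \<in> odd_perms" using odd_perm by (simp add: even_values_def odd_values_def)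
    then show ?thesis
      using transpose_odd_even_constant[OF n] is_minority_terms[OF n] that by metis
  qed
qed

lemma minority_not_even_perm:
  assumes m: "is_minority m" and g: "breaks_cycle g"
  obtains m' where "is_minority m'" "even_values m' \<notin> even_perms"
proof (cases "even_values m \<in> even_perms")
  case True
  have "\<exists>n. is_minority n \<and> even_values n = [0, 1, 2]"
    using True m is_minority_terms(6,7)[OF m] unfolding even_perms_def even_values_def
    by (elim insertE emptyE) auto
  then obtain n where n: "is_minority n" "even_values n = [0, 1, 2]" by blast
  note nD = is_minorityD[OF n(1)]
  have tg: "ternary g" using g unfolding breaks_cycle_def by blast
  define h where "h x y z = g (n x y z) (n y z x) (n z x y)" for x y z
  have "is_minority h" unfolding h_def
    by (rule is_minorityI; (intro ternary_compose[OF tg] ternary_compose[OF nD(1)] ternary_proj)?;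
        simp add: nD ternary_idempotent[OF tg])
  moreover have "even_values h = [g 0 1 2, g 1 2 0, g 2 0 1]"
    using n(2) by (simp add: even_values_def h_def)
  then have "even_values h \<notin> even_perms"
    using g unfolding breaks_cycle_def even_perms_def by auto
  ultimately show ?thesis by (rule that)
qed (use m that in blast)

lemma minority_odd_constant:
  assumes m: "is_minority m" and even: "even_values m = [k, k, k]"
  obtains m' l where "is_minority m'" "even_values m' = [k, k, k]" "odd_values m' = [l, l, l]"
proof -
  obtain a b c where odd: "odd_values m = [a, b, c]" by (simp add: odd_values_def)
  have abc: "a \<in> A" "b \<in> A" "c \<in> A" and k: "k \<in> A"
    using even_values_mem[OF m even] odd_values_mem[OF m odd] by auto
  have even_rotate: "even_values (rotate_left m) = [k, k, k]" "even_values (rotate_right m) = [k, k, k]"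
    using even is_minorityD(2)[OF m k k] by (auto simp: even_values_def rotate_left_def rotate_right_def)
  have odd_left: "odd_values (rotate_left m) = [m a c b, m b a c, m c b a]"
    and odd_right: "odd_values (rotate_right m) = [m a b c, m b c a, m c a b]"
    using odd by (auto simp: odd_values_def rotate_left_def rotate_right_def)
  consider (repeated) "\<not> distinct [a, b, c]" | (even_perm) "[a, b, c] \<in> even_perms"
    | (odd_perm) "[a, b, c] \<in> odd_perms"
    using distinct_triple_cases[OF abc] by blast
  then have "\<exists>l. odd_values (rotate_left m) = [l, l, l] \<or> odd_values (rotate_right m) = [l, l, l]"
  proof cases
    case repeated
    then show ?thesis using odd_left is_minorityD[OF m] abc by auto
  next
    case even_perm
    then show ?thesis using odd_right even unfolding even_perms_def even_values_def by auto
  next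
    case odd_perm
    then show ?thesis using odd_left even unfolding odd_perms_def even_values_def by auto
  qed
  then show ?thesis using even_rotate is_minority_terms(1,2)[OF m] that by blast
qed

lemma sym_minority_if_constant:
  assumes m: "is_minority m" and even: "even_values m = [c, c, c]" and odd: "odd_values m = [c, c, c]"
  shows "c \<in> A" "ternary (sym_minority c)"
proof -
  have "m x y z = sym_minority c x y z" if xyz: "x \<in> A" "y \<in> A" "z \<in> A" for x y z
  proof (cases "distinct [x, y, z]")
    case True
    then have "[x, y, z] \<in> even_perms \<union> odd_perms" using distinct_triple_cases[OF xyz] by blast
    then have "m x y z = c"
      using even odd unfolding even_perms_def odd_perms_def even_values_def odd_values_def by auto
    then show ?thesis using sym_minority_distinct[OF True] by simp
  next
    case False
    then show ?thesis using is_minorityD[OF m] xyz by auto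
  qed
  then show "ternary (sym_minority c)" by (rule ternary_cong[OF is_minorityD(1)[OF m]])
  show "c \<in> A" using even_values_mem[OF m even] by blast
qed

lemma transpose_even_constant:
  assumes m: "is_minority m" and even: "even_values m = [k, k, k]" and odd: "odd_values m = [l, l, l]"
    and klc: "distinct [k, l, c]" "c \<in> A"
  shows "even_values (transpose_even m) = [c, c, c]" "odd_values (transpose_even m) = [c, c, c]"
proof -
  have "k \<in> A" "l \<in> A" using even_values_mem[OF m even] odd_values_mem[OF m odd] by auto
  then show "even_values (transpose_even m) = [c, c, c]" "odd_values (transpose_even m) = [c, c, c]"
    using even odd klc is_minorityD[OF m]
    unfolding carrier even_values_def odd_values_def transpose_even_def Let_def
    by (elim insertE emptyE; simp)+
qed

lemma sym_minority_exists:
  assumes "is_minority m" "breaks_cycle g"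
  obtains c where "c \<in> A" "ternary (sym_minority c)"
proof -
  obtain m1 where "is_minority m1" "even_values m1 \<notin> even_perms"
    using minority_not_even_perm[OF assms] .
  then obtain m2 k where "is_minority m2" "even_values m2 = [k, k, k]"
    by (rule minority_even_constant_if_not_even_perm)
  then obtain m3 l where m3: "is_minority m3" "even_values m3 = [k, k, k]" "odd_values m3 = [l, l, l]"
    by (rule minority_odd_constant)
  show ?thesis
  proof (cases "k = l")
    case True
    then show ?thesis using sym_minority_if_constant m3 that by metis
  next
    case False
    obtain c where "c \<in> A" "c \<noteq> k" "c \<noteq> l" using third_element .
    with False have "c \<in> A" "distinct [k, l, c]" by auto
    then show ?thesis
      using sym_minority_if_constant(2) is_minority_terms(3)[OF m3(1)] transpose_even_constant[OF m3] that
      by metis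
  qed
qed

lemma breaks_cycle_exists:
  assumes "\<not> clone_preserves C 2 phi"
  obtains g where "breaks_cycle g"
proof -
  have phi_iff: "[x, y] \<in> phi \<longleftrightarrow> x \<in> A \<and> y = (x + 1) mod 3" for x y
    unfolding phi_def carrier by auto
  have phi_2: "length r = 2" if "r \<in> phi" for r using that unfolding phi_def by auto
  obtain n f cs where f: "(n, f) \<in> C" and cs: "length cs = 2" "\<forall>c\<in>set cs. length c = n"
    "\<forall>i<n. map (\<lambda>c. c ! i) cs \<in> phi" "map f cs \<notin> phi"
    using assms preserves_columns[OF phi_2] unfolding clone_preserves_def by auto
  obtain x y where xy: "cs = [x, y]" using cs(1) by (auto simp: length_Suc_conv numeral_2_eq_2)
  have x: "x \<in> tuples A n" and y: "y = map (\<lambda>k. (k + 1) mod 3) x"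
    using cs(2,3) unfolding xy by (auto simp: phi_iff intro!: tuplesI nth_equalityI)
  have x_A: "set x \<subseteq> A" using x by (simp add: tuples_def)
  define g where "g = (\<lambda>u v w. f (map ((!) [u, v, w]) x))"
  have "ternary g"
    unfolding g_def ternary_iff[of "\<lambda>xs. f (map ((!) xs) x)"]
    using x_A length_tuple[OF x] by (intro in_clone_minor[OF in_clone_mem[OF f]]) (auto simp: carrier)
  moreover have "g 0 1 2 = f x" "g 1 2 0 = f y"
    unfolding g_def y using x_A by (auto simp: carrier intro!: arg_cong[of _ _ f] map_idI map_cong)
  then have "g 1 2 0 \<noteq> (g 0 1 2 + 1) mod 3"
    using cs(4) ternary_closed[OF \<open>ternary g\<close>, of 0 1 2] unfolding xy by (simp add: phi_iff)
  ultimately show ?thesis using that unfolding breaks_cycle_def by blast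
qed

end

subsection \<open>The parity operations\<close>

definition parity_value :: "nat \<Rightarrow> nat \<Rightarrow> nat \<Rightarrow> nat list \<Rightarrow> nat" where
  "parity_value p q c xs =
     (if odd (count_list xs c) then c else if odd (count_list xs q) then q else p)"

fun nested_sym_minority :: "nat \<Rightarrow> nat list \<Rightarrow> nat" where
  "nested_sym_minority c [] = c"
| "nested_sym_minority c [x] = x"
| "nested_sym_minority c (x # y # zs) = sym_minority c (nested_sym_minority c zs) x y"

lemma nested_sym_minority_drop_c:
  "nested_sym_minority c (replicate (2 * k) c @ ys) = nested_sym_minority c ys"
  by (induction k) simp_all

locale sym_minority_clone = idempotent_clone_on +
  fixes p q c :: nat
  assumes carrier: "A = {p, q, c}" and distinct: "distinct [p, q, c]"
    and sym: "ternary (sym_minority c)"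
begin

abbreviation "s \<equiv> sym_minority c"
abbreviation "nested \<equiv> nested_sym_minority c"
abbreviation "parity \<equiv> parity_value p q c"

lemma c_mem: "c \<in> A"
  by (simp add: carrier)

lemma pqc_neq: "p \<noteq> q" "q \<noteq> p" "p \<noteq> c" "c \<noteq> p" "q \<noteq> c" "c \<noteq> q"
  using distinct by auto

lemma s_closed: "x \<in> A \<Longrightarrow> y \<in> A \<Longrightarrow> z \<in> A \<Longrightarrow> s x y z \<in> A"
  by (rule ternary_closed[OF sym])

lemma s_eq_c_iff:
  "x \<in> A \<Longrightarrow> y \<in> A \<Longrightarrow> z \<in> A \<Longrightarrow> s x y z = c \<longleftrightarrow> ((x = c) = ((y = c) = (z = c)))"
  unfolding carrier by (elim insertE emptyE) (simp_all add: sym_minority_def pqc_neq)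

text \<open>Being equal to \<^term>\<open>c\<close> is a congruence of \<^term>\<open>s\<close>, and on each congruence class \<^term>\<open>s\<close>
  provides a case distinction on whether a third argument is \<^term>\<open>c\<close>.\<close>

lemma s_select:
  "x \<in> A \<Longrightarrow> y \<in> A \<Longrightarrow> z \<in> A \<Longrightarrow> x = c \<longleftrightarrow> y = c \<Longrightarrow>
    s (s x y z) y z = (if z = c then y else x)"
  unfolding carrier by (elim insertE emptyE) (simp_all add: sym_minority_def pqc_neq)

lemma in_clone_if_eq_c:
  assumes "in_clone n f" "in_clone n g" "in_clone n h"
    and "\<And>xs. xs \<in> tuples A n \<Longrightarrow> f xs = c \<longleftrightarrow> g xs = c"
  shows "in_clone n (\<lambda>xs. if h xs = c then g xs else f xs)"
proof (rule in_clone_cong)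
  show "in_clone n (\<lambda>xs. s (s (f xs) (g xs) (h xs)) (g xs) (h xs))"
    by (intro ternary_apply[OF sym] assms(1-3))
qed (simp add: s_select assms(4) in_clone_closed[OF assms(1)] in_clone_closed[OF assms(2)]
    in_clone_closed[OF assms(3)])

lemma in_clone_by_c_pattern:
  assumes G: "\<And>S. in_clone n (G S)"
    and class_eq: "\<And>S xs. xs \<in> tuples A n \<Longrightarrow> G S xs = c \<longleftrightarrow> f xs = c"
    and pattern: "\<And>xs. xs \<in> tuples A n \<Longrightarrow> G {i. i < n \<and> xs ! i = c} xs = f xs"
  shows "in_clone n f"
proof -
  have "in_clone n (\<lambda>xs. G ({i. i < k \<and> xs ! i = c} \<union> S) xs)" if "k \<le> n" for k S
    using that
  proof (induction k arbitrary: S)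
    case 0
    then show ?case using G by simp
  next
    case (Suc k)
    let ?f = "\<lambda>S xs. G ({i. i < k \<and> xs ! i = c} \<union> S) xs"
    have "in_clone n (\<lambda>xs. if xs ! k = c then ?f (insert k S) xs else ?f S xs)"
      using Suc.prems
      by (intro in_clone_if_eq_c[OF Suc.IH Suc.IH in_clone_proj])
        (simp_all add: class_eq del: Un_insert_right)
    moreover have "{i. i < Suc k \<and> xs ! i = c} \<union> S
        = (if xs ! k = c then {i. i < k \<and> xs ! i = c} \<union> insert k S
           else {i. i < k \<and> xs ! i = c} \<union> S)" for xs
      by (auto simp: less_Suc_eq)
    ultimately show ?case by (elim in_clone_cong) simp
  qed
  from this[of n "{}"] show ?thesis using pattern by (auto elim: in_clone_cong)
qed

lemma in_clone_nested:
  "odd (length is) \<Longrightarrow> set is \<subseteq> {..<n} \<Longrightarrow> in_clone n (\<lambda>xs. nested (map ((!) xs) is))"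
proof (induction "is" rule: induct_list012)
  case (3 i j js)
  then show ?case by (auto intro!: ternary_apply[OF sym] in_clone_proj)
qed (auto intro: in_clone_proj)

lemma nested_closed: "set ys \<subseteq> A \<Longrightarrow> nested ys \<in> A"
  by (induction ys rule: induct_list012) (auto intro: s_closed c_mem)

lemma nested_eq_c_iff:
  "odd (length ys) \<Longrightarrow> set ys \<subseteq> A \<Longrightarrow> nested ys = c \<longleftrightarrow> odd (count_list ys c)"
  by (induction ys rule: induct_list012) (auto simp: s_eq_c_iff nested_closed)

lemma nested_eq_parity:
  "odd (length ys) \<Longrightarrow> set ys \<subseteq> {p, q} \<Longrightarrow> nested ys = parity ys"
proof (induction ys rule: induct_list012)
  case (3 x y zs)
  have "count_list zs c = 0" using 3 pqc_neq by (auto simp: count_list_0_iff)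
  then show ?case using 3 by (auto simp: parity_value_def sym_minority_def pqc_neq)
qed (auto simp: parity_value_def pqc_neq)

lemma parity_eq_c_iff: "parity ys = c \<longleftrightarrow> odd (count_list ys c)"
  using pqc_neq by (simp add: parity_value_def)

text \<open>For an argument tuple in which \<^term>\<open>c\<close> occurs evenly often, the nested term in which the
  arguments equal to \<^term>\<open>c\<close> come first cancels them in pairs.\<close>

lemma nested_c_first:
  assumes "odd (length ys)" "set ys \<subseteq> A"
  shows "nested (filter (\<lambda>y. c = y) ys @ filter (\<lambda>y. c \<noteq> y) ys) = parity ys"
    (is "nested (?cs @ ?zs) = _")
proof -
  have length: "length ?cs + length ?zs = length ys" by (rule sum_length_filter_compl)
  have count_c: "length ?cs = count_list ys c" by (simp add: count_list_eq_length_filter)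
  have count: "count_list ?zs a = (if a = c then 0 else count_list ys a)" for a
    by (induction ys) auto
  show ?thesis
  proof (cases "even (count_list ys c)")
    case True
    then obtain k where "count_list ys c = 2 * k" by (rule evenE)
    then have "?cs = replicate (2 * k) c" using count_c replicate_length_filter[of c ys] by simp
    then have "nested (?cs @ ?zs) = nested ?zs" by (simp add: nested_sym_minority_drop_c)
    also have "\<dots> = parity ?zs"
    proof (rule nested_eq_parity)
      show "odd (length ?zs)" using assms(1) length True count_c by (metis even_add)
      show "set ?zs \<subseteq> {p, q}" using assms(2) unfolding carrier by auto
    qed
    also have "\<dots> = parity ys" using True by (simp add: parity_value_def count)
    finally show ?thesis .
  next
    case False
    have "count_list (?cs @ ?zs) c = count_list ys c" by (induction ys) auto
    moreover have "odd (length (?cs @ ?zs))" "set (?cs @ ?zs) \<subseteq> A" using assms length by auto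
    ultimately have "nested (?cs @ ?zs) = c" using False nested_eq_c_iff by metis
    then show ?thesis using False by (simp add: parity_value_def)
  qed
qed

lemma in_clone_parity:
  assumes "odd (length is)" "set is \<subseteq> {..<n}"
  shows "in_clone n (\<lambda>xs. parity (map ((!) xs) is))"
proof (rule in_clone_by_c_pattern)
  let ?js = "\<lambda>S. filter (\<lambda>i. i \<in> S) is @ filter (\<lambda>i. i \<notin> S) is"
  let ?G = "\<lambda>S xs. nested (map ((!) xs) (?js S))"
  have odd_js: "odd (length (?js S))" for S using assms(1) by (simp add: sum_length_filter_compl)
  show "in_clone n (?G S)" for S using odd_js assms(2) by (intro in_clone_nested) auto
  fix xs assume xs: "xs \<in> tuples A n"
  have values_A: "set (map ((!) xs) is) \<subseteq> A" using assms(2) tuples_nth[OF xs] by auto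
  show "?G S xs = c \<longleftrightarrow> parity (map ((!) xs) is) = c" for S
  proof -
    have "count_list (map ((!) xs) (?js S)) c = count_list (map ((!) xs) is) c"
      by (induction "is") auto
    then show ?thesis using odd_js[of S] values_A
      by (subst nested_eq_c_iff) (auto simp: parity_eq_c_iff)
  qed
  have "i < n" if "i \<in> set is" for i using assms(2) that by auto
  then have "map ((!) xs) (?js {i. i < n \<and> xs ! i = c})
      = filter (\<lambda>y. c = y) (map ((!) xs) is) @ filter (\<lambda>y. c \<noteq> y) (map ((!) xs) is)"
    by (simp add: filter_map o_def eq_commute[of c] cong: filter_cong)
  then show "?G {i. i < n \<and> xs ! i = c} xs = parity (map ((!) xs) is)"
    using nested_c_first[of "map ((!) xs) is"] assms(1) values_A by simp
qed

end

subsection \<open>The clone of idempotent affine operations modulo 2\<close>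

lemma affine2_rel_iff:
  "[x, y, z, w] \<in> affine2_rel \<longleftrightarrow> {x, y, z, w} \<subseteq> {0, 1} \<and> even (x + y + z + w)"
  unfolding affine2_rel_def by auto

definition preserves_even_sums :: "nat \<Rightarrow> (nat list \<Rightarrow> nat) \<Rightarrow> bool" where
  "preserves_even_sums n f \<longleftrightarrow>
    (\<forall>x y z w. {x, y, z, w} \<subseteq> tuples {0, 1} n \<and> (\<forall>i<n. even (x ! i + y ! i + z ! i + w ! i))
      \<longrightarrow> even (f x + f y + f z + f w))"

lemma preserves_affine2_rel_iff:
  assumes f: "f \<in> ops {0, 1} n"
  shows "preserves n f 4 affine2_rel \<longleftrightarrow> preserves_even_sums n f"
proof -
  have f_mem: "f u \<in> {0, 1}" if "u \<in> tuples {0, 1} n" for u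
    using f that unfolding ops_def by (rule PiE_mem)
  have rows: "(\<forall>u\<in>{x, y, z, w}. length u = n) \<and> (\<forall>i<n. [x ! i, y ! i, z ! i, w ! i] \<in> affine2_rel)
      \<longleftrightarrow> {x, y, z, w} \<subseteq> tuples {0, 1} n \<and> (\<forall>i<n. even (x ! i + y ! i + z ! i + w ! i))"
    for x y z w
    unfolding affine2_rel_iff tuples_iff_nth insert_subset by blast
  have all_length_4: "(\<forall>cs. length cs = 4 \<longrightarrow> P cs) \<longleftrightarrow> (\<forall>x y z w. P [x, y, z, w])"
    for P :: "nat list list \<Rightarrow> bool"
    by (auto simp: length_Suc_conv numeral_eq_Suc)
  have "length r = 4" if "r \<in> affine2_rel" for r using that by (auto simp: affine2_rel_def)
  then have columns: "preserves n f 4 affine2_rel \<longleftrightarrow> (\<forall>cs. length cs = 4 \<longrightarrow>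
      (\<forall>c\<in>set cs. length c = n) \<and> (\<forall>i<n. map (\<lambda>c. c ! i) cs \<in> affine2_rel) \<longrightarrow> map f cs \<in> affine2_rel)"
    by (subst preserves_columns) auto
  have "preserves n f 4 affine2_rel \<longleftrightarrow>
      (\<forall>x y z w. (\<forall>u\<in>{x, y, z, w}. length u = n) \<and>
        (\<forall>i<n. [x ! i, y ! i, z ! i, w ! i] \<in> affine2_rel) \<longrightarrow> [f x, f y, f z, f w] \<in> affine2_rel)"
    unfolding columns all_length_4 by simp
  also have "\<dots> \<longleftrightarrow> preserves_even_sums n f"
    unfolding rows preserves_even_sums_def using f_mem by (simp add: affine2_rel_iff)
  finally show ?thesis .
qed

lemma preserves_singleton_iff: "preserves n f 1 {[a]} \<longleftrightarrow> f (replicate n a) = a"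
proof -
  have "length rs = n \<and> set rs \<subseteq> {[a]} \<longleftrightarrow> rs = replicate n [a]" for rs
    by (auto intro: replicate_eqI)
  then show ?thesis unfolding preserves_def by simp
qed

lemma Z2_iff:
  "(n, f) \<in> Z2 \<longleftrightarrow> 1 \<le> n \<and> f \<in> ops {0, 1} n \<and> preserves_even_sums n f \<and>
     f (replicate n 0) = 0 \<and> f (replicate n 1) = 1"
  unfolding Z2_def Pol_def
  using preserves_affine2_rel_iff preserves_singleton_iff[of n f] by auto

definition indicator_tuple :: "nat \<Rightarrow> nat set \<Rightarrow> nat list" where
  "indicator_tuple n X = map (\<lambda>i. of_bool (i \<in> X)) [0..<n]"

lemma indicator_tuple_mem: "indicator_tuple n X \<in> tuples {0, 1} n"
  by (auto simp: indicator_tuple_def tuples_def)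

lemma indicator_tuple_empty: "indicator_tuple n {} = replicate n 0"
  by (simp add: indicator_tuple_def map_replicate_const)

lemma tuple_eq_indicator_tuple:
  assumes xs: "xs \<in> tuples {0, 1} n"
  shows "xs = indicator_tuple n {i. i < n \<and> xs ! i = 1}" (is "_ = ?ind")
proof (rule nth_equalityI)
  show "length xs = length ?ind" using length_tuple[OF xs] by (simp add: indicator_tuple_def)
  show "xs ! i = ?ind ! i" if "i < length xs" for i
    using that tuples_nth[OF xs, of i] length_tuple[OF xs] by (auto simp: indicator_tuple_def)
qed

lemma Z2_indicator_tuple:
  assumes f: "(n, f) \<in> Z2" and "finite X" "X \<subseteq> {..<n}"
  shows "even (f (indicator_tuple n X)) \<longleftrightarrow> even (\<Sum>i\<in>X. f (indicator_tuple n {i}))"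
  using assms(2,3)
proof (induction X)
  case empty
  then show ?case using f unfolding Z2_iff by (simp add: indicator_tuple_empty)
next
  case (insert i X)
  let ?ind = "indicator_tuple n"
  have "f (?ind {}) = 0" using f unfolding Z2_iff by (simp add: indicator_tuple_empty)
  moreover have "\<forall>k<n. even (?ind (insert i X) ! k + ?ind X ! k + ?ind {i} ! k + ?ind {} ! k)"
    using insert.hyps by (simp add: indicator_tuple_def)
  then have "even (f (?ind (insert i X)) + f (?ind X) + f (?ind {i}) + f (?ind {}))"
    using f indicator_tuple_mem unfolding Z2_iff preserves_even_sums_def by blast
  ultimately show ?case using insert by auto
qed

lemma Z2_parity:
  assumes f: "(n, f) \<in> Z2"
  obtains "is" where "set is \<subseteq> {..<n}" "odd (length is)"
    "\<And>xs. xs \<in> tuples {0, 1} n \<Longrightarrow> f xs = 1 \<longleftrightarrow> odd (count_list (map ((!) xs) is) 1)"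
proof -
  define "is" where "is = filter (\<lambda>i. odd (f (indicator_tuple n {i}))) [0..<n]"
  have parity: "f xs = 1 \<longleftrightarrow> odd (count_list (map ((!) xs) is) 1)" if xs: "xs \<in> tuples {0, 1} n" for xs
  proof -
    let ?X = "{i. i < n \<and> xs ! i = 1}"
    have "f xs \<in> {0, 1}" using f xs unfolding Z2_iff ops_def by blast
    then have "f xs = 1 \<longleftrightarrow> odd (f xs)" by auto
    also have "\<dots> \<longleftrightarrow> odd (\<Sum>i\<in>?X. f (indicator_tuple n {i}))"
      using Z2_indicator_tuple[OF f, of ?X] tuple_eq_indicator_tuple[OF xs] by auto
    also have "\<dots> \<longleftrightarrow> odd (card {i \<in> ?X. odd (f (indicator_tuple n {i}))})"
      by (simp add: even_sum_iff)
    also have "card {i \<in> ?X. odd (f (indicator_tuple n {i}))} = count_list (map ((!) xs) is) 1"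
      unfolding is_def count_list_eq_length_filter
      by (auto simp: filter_map o_def distinct_length_filter intro!: arg_cong[of _ _ card])
    finally show ?thesis .
  qed
  have "map ((!) (replicate n 1)) is = replicate (length is) (1 :: nat)"
    by (auto simp: is_def intro!: replicate_eqI)
  moreover have "f (replicate n 1) = 1" using f unfolding Z2_iff by blast
  ultimately have "odd (length is)"
    using parity[OF replicate_in_tuples, of 1] by (simp add: count_list_eq_length_filter)
  moreover have "set is \<subseteq> {..<n}" by (auto simp: is_def)
  ultimately show ?thesis using that parity by blast
qed

context sym_minority_clone
begin

definition from_Z2 :: "nat \<Rightarrow> (nat list \<Rightarrow> nat) \<Rightarrow> nat list \<Rightarrow> nat" where
  "from_Z2 = reflection A [\<lambda>x. of_bool (x = c), \<lambda>x. of_bool (x = q)]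
     (\<lambda>bs. if bs ! 0 = 1 then c else if bs ! 1 = 1 then q else p)"

lemma from_Z2_mem:
  assumes f: "(n, f) \<in> Z2"
  shows "(n, from_Z2 n f) \<in> C"
proof -
  obtain "is" where "is": "set is \<subseteq> {..<n}" "odd (length is)"
    and parity: "\<And>xs. xs \<in> tuples {0, 1} n \<Longrightarrow> f xs = 1 \<longleftrightarrow> odd (count_list (map ((!) xs) is) 1)"
    using Z2_parity[OF f] by blast
  have "f (map (\<lambda>x. of_bool (x = a)) xs) = 1 \<longleftrightarrow> odd (count_list (map ((!) xs) is) a)"
    if xs: "xs \<in> tuples A n" for xs a
  proof -
    let ?bs = "map (\<lambda>x. of_bool (x = a)) xs :: nat list"
    have "?bs \<in> tuples {0, 1} n" by (rule map_in_tuples[OF xs]) simp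
    then have "f ?bs = 1 \<longleftrightarrow> odd (count_list (map ((!) ?bs) is) 1)" by (rule parity)
    also have "map ((!) ?bs) is = map (\<lambda>y. of_bool (y = a)) (map ((!) xs) is)"
      using "is"(1) length_tuple[OF xs] by auto
    also have "count_list \<dots> 1 = count_list (map ((!) xs) is) a"
      by (induction "is") auto
    finally show ?thesis .
  qed
  then have "from_Z2 n f = restrict (\<lambda>xs. parity_value p q c (map ((!) xs) is)) (tuples A n)"
    unfolding from_Z2_def reflection_def by (intro restrict_ext) (simp add: parity_value_def)
  then show ?thesis using in_clone_parity[OF "is"(2,1)] unfolding in_clone_def by simp
qed

lemma minion_hom_from_Z2: "minion_hom {0, 1} Z2 A C from_Z2"
  unfolding from_Z2_def
  by (rule minion_hom_reflection; (erule from_Z2_mem[unfolded from_Z2_def])?) auto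

end

subsection \<open>A relation witnessing the absence of a majority operation\<close>

lemma minimal_failure:
  assumes "finite K" "\<not> P K" "P {}" "\<And>x y. x \<in> K \<Longrightarrow> y \<in> K \<Longrightarrow> P {x, y}"
  obtains L x y z where "L \<subseteq> K" "x \<in> K" "y \<in> K" "z \<in> K"
    "P (L \<union> {x, y})" "P (L \<union> {x, z})" "P (L \<union> {y, z})" "\<not> P (L \<union> {x, y, z})"
proof -
  let ?failures = "{M. M \<subseteq> K \<and> \<not> P M}"
  have "finite ?failures" "?failures \<noteq> {}" using assms(1,2) by auto
  then obtain M where M: "M \<subseteq> K" "\<not> P M" and minimal: "\<And>N. N \<in> ?failures \<Longrightarrow> N \<subseteq> M \<Longrightarrow> M = N"
    using finite_has_minimal by (metis (no_types, lifting) mem_Collect_eq)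
  have "M \<noteq> {}" using M(2) assms(3) by metis
  then obtain x where x: "x \<in> M" by blast
  have not_pair: "M \<noteq> {x, y}" if "y \<in> M" for y using assms(4)[of x y] x that M by auto
  obtain y where y: "y \<in> M" "y \<noteq> x" using not_pair[OF x] x by blast
  obtain z where z: "z \<in> M" "z \<noteq> x" "z \<noteq> y" using not_pair[OF y(1)] x y by blast
  have remove: "P (M - {u})" if "u \<in> M" for u using minimal[of "M - {u}"] that M(1) by blast
  have "M - {x, y, z} \<union> {x, y} = M - {z}" "M - {x, y, z} \<union> {x, z} = M - {y}"
    "M - {x, y, z} \<union> {y, z} = M - {x}" "M - {x, y, z} \<union> {x, y, z} = M"
    using x y z by auto
  note decomposition = this
  show ?thesis
  proof (rule that[of "M - {x, y, z}" x y z], unfold decomposition)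
    show "M - {x, y, z} \<subseteq> K" "x \<in> K" "y \<in> K" "z \<in> K" using M(1) x y z by blast+
  qed (use remove x y(1) z(1) M(2) in simp_all)
qed

context idempotent_clone_on
begin

definition separating_relation :: "nat list set \<Rightarrow> nat list \<Rightarrow> nat list \<Rightarrow> bool" where
  "separating_relation R t a \<longleftrightarrow> R \<subseteq> tuples A 3 \<and> clone_preserves C 3 R \<and>
     t \<in> tuples A 3 \<and> a \<in> tuples A 3 \<and> (\<forall>i<3. t[i := a ! i] \<in> R) \<and> t \<notin> R"

definition interpolates :: "nat \<Rightarrow> (nat list \<Rightarrow> nat) \<Rightarrow> nat list set \<Rightarrow> (nat list \<Rightarrow> nat) \<Rightarrow> bool" where
  "interpolates n g K F \<longleftrightarrow> (n, F) \<in> C \<and> (\<forall>u\<in>K. F u = g u)"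

lemma clone_preserves_interpolant_values:
  assumes K: "K \<subseteq> tuples A n" "\<And>u. u \<in> K \<Longrightarrow> g u \<in> A" and us: "set us \<subseteq> tuples A n"
  shows "clone_preserves C (length us) {map F us |F. interpolates n g K F}"
  unfolding clone_preserves_def preserves_def
proof clarify
  fix f rs
  assume f: "(length rs, f) \<in> C" and rs: "set rs \<subseteq> {map F us |F. interpolates n g K F}"
  then have "\<forall>r\<in>set rs. \<exists>F. interpolates n g K F \<and> map F us = r" by blast
  then obtain F where F: "\<And>r. r \<in> set rs \<Longrightarrow> interpolates n g K (F r)"
    and rows: "\<And>r. r \<in> set rs \<Longrightarrow> map (F r) us = r" by metis
  define H where "H = compose A n f (map F rs)"
  have H_apply: "H u = f (map (\<lambda>r. F r u) rs)" if "u \<in> tuples A n" for u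
    using that by (simp add: H_def compose_def o_def)
  have "rs \<noteq> []" using mem_arity_pos[OF f] by auto
  then have "1 \<le> n" using F mem_arity_pos unfolding interpolates_def by (metis list.set_sel(1))
  then have "(n, H) \<in> C"
    using is_clone f F unfolding is_clone_def H_def interpolates_def by auto
  moreover have "H u = g u" if u: "u \<in> K" for u
  proof -
    have "map (\<lambda>r. F r u) rs = replicate (length rs) (g u)"
      using F u unfolding interpolates_def by (auto intro!: replicate_eqI)
    then show ?thesis using H_apply mem_idempotent[OF f K(2)[OF u]] K(1) u by auto
  qed
  ultimately have "interpolates n g K H" unfolding interpolates_def by blast
  moreover have "r ! j = F r (us ! j)" if "r \<in> set rs" "j < length us" for r j
    using nth_map[OF that(2)] rows[OF that(1)] by metis
  then have "map (\<lambda>j. f (map (\<lambda>r. r ! j) rs)) [0..<length us] = map H us"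
    using us by (auto simp: H_apply subset_iff intro!: nth_equalityI arg_cong[of _ _ f])
  ultimately show "\<exists>F. map (\<lambda>j. f (map (\<lambda>r. r ! j) rs)) [0..<length us] = map F us \<and> interpolates n g K F"
    by blast
qed

lemma interpolation_failure_relation:
  assumes K: "finite K" "K \<subseteq> tuples A n" "\<And>u. u \<in> K \<Longrightarrow> g u \<in> A"
    and interpolable: "\<exists>F. interpolates n g {} F"
      "\<And>u v. u \<in> K \<Longrightarrow> v \<in> K \<Longrightarrow> \<exists>F. interpolates n g {u, v} F"
    and failure: "\<not> (\<exists>F. interpolates n g K F)"
  obtains R t a where "separating_relation R t a"
proof -
  let ?I = "interpolates n g"
  obtain L x y z where L: "L \<subseteq> K" and xyz: "x \<in> K" "y \<in> K" "z \<in> K"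
    and "\<exists>F. ?I (L \<union> {x, y}) F" "\<exists>F. ?I (L \<union> {x, z}) F" "\<exists>F. ?I (L \<union> {y, z}) F"
    and none: "\<not> (\<exists>F. ?I (L \<union> {x, y, z}) F)"
    using minimal_failure[of K "\<lambda>K. \<exists>F. ?I K F", OF K(1) failure interpolable] by metis
  then obtain Fx Fy Fz where F: "?I (L \<union> {y, z}) Fx" "?I (L \<union> {x, z}) Fy" "?I (L \<union> {x, y}) Fz"
    by blast
  define R where "R = {map F [x, y, z] |F. ?I L F}"
  let ?t = "map g [x, y, z]" and ?a = "[Fx x, Fy y, Fz z]"
  have closed: "F u \<in> A" if "(n, F) \<in> C" "u \<in> K" for F u
    using in_clone_closed[OF in_clone_mem] K(2) that by blast
  have "R \<subseteq> tuples A 3" using closed xyz by (auto simp: R_def interpolates_def tuples_def)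
  moreover have "clone_preserves C (length [x, y, z]) R"
    unfolding R_def using L K xyz by (intro clone_preserves_interpolant_values) auto
  moreover have "?t \<in> tuples A 3" using K(3) xyz by (simp add: tuples_def)
  moreover have "?a \<in> tuples A 3" using closed F xyz by (simp add: tuples_def interpolates_def)
  moreover have "?t[i := ?a ! i] \<in> R" if "i < 3" for i
  proof -
    have "?t[0 := ?a ! 0] = map Fx [x, y, z]" "?t[1 := ?a ! 1] = map Fy [x, y, z]"
      "?t[2 := ?a ! 2] = map Fz [x, y, z]" "?I L Fx" "?I L Fy" "?I L Fz"
      using F by (auto simp: interpolates_def)
    then have "?t[0 := ?a ! 0] \<in> R" "?t[1 := ?a ! 1] \<in> R" "?t[2 := ?a ! 2] \<in> R"
      unfolding R_def by blast+
    then show ?thesis using that by (auto simp: less_Suc_eq numeral_3_eq_3)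
  qed
  moreover have "?t \<notin> R" using none by (auto simp: R_def interpolates_def)
  ultimately show ?thesis
    by (intro that[of R ?t ?a]) (simp add: separating_relation_def numeral_3_eq_3)
qed

definition near_unanimous :: "nat list set" where
  "near_unanimous = {u \<in> tuples A 3. \<not> distinct u}"

definition majority_value :: "nat list \<Rightarrow> nat" where
  "majority_value u = (if u ! 0 = u ! 1 then u ! 0 else u ! 2)"

lemma near_unanimous_tuples: "near_unanimous \<subseteq> tuples A 3"
  by (auto simp: near_unanimous_def)

lemma majority_value_mem: "u \<in> near_unanimous \<Longrightarrow> majority_value u \<in> A"
  using tuples_nth[of u A 3] by (simp add: near_unanimous_def majority_value_def)

text \<open>Two near-unanimous triples share a coordinate at which both have their majority value.\<close>

lemma projection_interpolates_majority_value:
  assumes uv: "u \<in> near_unanimous" "v \<in> near_unanimous"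
  shows "\<exists>F. interpolates 3 majority_value {u, v} F"
proof -
  have "\<exists>i\<in>{0, 1, 2}. u ! i = majority_value u \<and> v ! i = majority_value v"
    using uv by (auto simp: near_unanimous_def tuples_3 majority_value_def)
  then obtain i where "i \<in> {0, 1, 2}" "u ! i = majority_value u" "v ! i = majority_value v" by blast
  moreover from this have "i < 3" by auto
  ultimately have "interpolates 3 majority_value {u, v} (proj A 3 i)"
    using proj_mem near_unanimous_tuples uv by (auto simp: interpolates_def proj_def)
  then show ?thesis by blast
qed

lemma majority_if_interpolates:
  assumes "interpolates 3 majority_value near_unanimous F"
  shows "has_majority A C"
proof -
  have "F [x, y, y] = y \<and> F [y, x, y] = y \<and> F [y, y, x] = y" if "x \<in> A" "y \<in> A" for x y
    using assms that unfolding interpolates_def near_unanimous_def majority_value_def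
    by (auto simp: tuples_3)
  then show ?thesis using assms unfolding has_majority_def interpolates_def by blast
qed

lemma no_majority_relation:
  assumes "finite A" "\<not> has_majority A C"
  obtains R t a where "separating_relation R t a"
proof (rule interpolation_failure_relation)
  show "finite near_unanimous"
    using finite_subset[OF near_unanimous_tuples] finite_tuples assms(1) by blast
  show "\<exists>F. interpolates 3 majority_value {} F" using proj_mem[of 0 3] by (auto simp: interpolates_def)
  show "\<not> (\<exists>F. interpolates 3 majority_value near_unanimous F)"
    using majority_if_interpolates assms(2) by blast
qed (use near_unanimous_tuples majority_value_mem projection_interpolates_majority_value that in auto)

end

subsection \<open>The homomorphism to affine operations modulo 2\<close>

lemma Z2_if_odd_sums:
  assumes n: "1 \<le> n" and f: "f \<in> ops {0, 1} n" "f (replicate n 0) = 0" "f (replicate n 1) = 1"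
    and g: "g (replicate n 0) = (0 :: nat)"
    and odd: "\<And>x y z. x \<in> tuples {0, 1} n \<Longrightarrow> y \<in> tuples {0, 1} n \<Longrightarrow> z \<in> tuples {0, 1} n \<Longrightarrow>
      (\<And>i. i < n \<Longrightarrow> odd (x ! i + y ! i + z ! i)) \<Longrightarrow> odd (f x + g y + h z)"
  shows "(n, f) \<in> Z2"
proof -
  define complement where
    "complement x y = map (\<lambda>i. of_bool (even (x ! i + y ! i)) :: nat) [0..<n]" for x y :: "nat list"
  have odd_complement: "odd (f x + g y + h (complement x y))"
    if "x \<in> tuples {0, 1} n" "y \<in> tuples {0, 1} n" for x y
    using that by (intro odd) (auto simp: complement_def tuples_def)
  have f_eq_g: "even (f x + g x)" if x: "x \<in> tuples {0, 1} n" for x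
  proof -
    let ?zero = "replicate n 0"
    have "odd (f x + g ?zero + h (complement x ?zero))" "odd (f ?zero + g x + h (complement ?zero x))"
      using odd_complement x replicate_in_tuples[of 0] by simp_all
    moreover have "complement ?zero x = complement x ?zero" by (simp add: complement_def)
    ultimately show ?thesis using f(2) g by simp
  qed
  have "even (f x + f y + f z + f w)"
    if tuples: "{x, y, z, w} \<subseteq> tuples {0, 1} n"
      and even: "\<forall>i<n. even (x ! i + y ! i + z ! i + w ! i)" for x y z w
  proof -
    have "complement x y = complement z w" using even by (auto simp: complement_def)
    then show ?thesis
      using odd_complement[of x y] odd_complement[of z w] f_eq_g[of y] f_eq_g[of w] tuples by auto
  qed
  then show ?thesis unfolding Z2_iff preserves_even_sums_def using n f by blast
qed

locale parity_relation = sym_minority_clone +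
  fixes R :: "nat list set" and t a :: "nat list"
  assumes separating: "separating_relation R t a"
begin

lemma R_tuples: "R \<subseteq> tuples A 3"
  and R_preserved: "clone_preserves C 3 R"
  and t_tuple: "t \<in> tuples A 3"
  and a_tuple: "a \<in> tuples A 3"
  and update_mem: "i < 3 \<Longrightarrow> t[i := a ! i] \<in> R"
  and t_notin: "t \<notin> R"
  using separating unfolding separating_relation_def by blast+

lemma R_length: "v \<in> R \<Longrightarrow> length v = 3"
  using R_tuples length_tuple by blast

lemma R_nth: "v \<in> R \<Longrightarrow> i < 3 \<Longrightarrow> v ! i \<in> A"
  using R_tuples tuples_nth by blast

lemma R_columns:
  assumes "(n, f) \<in> C" "length x = n" "length y = n" "length z = n"
    and "\<And>i. i < n \<Longrightarrow> [x ! i, y ! i, z ! i] \<in> R"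
  shows "[f x, f y, f z] \<in> R"
proof -
  have "preserves n f 3 R" using R_preserved assms(1) unfolding clone_preserves_def by blast
  then show ?thesis
    using R_length preserves_columns[THEN iffD1, THEN spec, of R 3 n f "[x, y, z]"] assms(2-) by simp
qed

definition combine :: "nat list \<Rightarrow> nat list \<Rightarrow> nat list \<Rightarrow> nat list" where
  "combine x y z = map (\<lambda>l. s (x ! l) (y ! l) (z ! l)) [0..<3]"

lemma combine_nth: "l < 3 \<Longrightarrow> combine x y z ! l = s (x ! l) (y ! l) (z ! l)"
  by (simp add: combine_def)

lemma combine_mem:
  assumes xyz: "x \<in> R" "y \<in> R" "z \<in> R"
  shows "combine x y z \<in> R"
proof -
  let ?s = "restrict (\<lambda>xs. s (xs ! 0) (xs ! 1) (xs ! 2)) (tuples A 3)"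
  have "preserves 3 ?s 3 R"
    using R_preserved sym unfolding clone_preserves_def ternary_def in_clone_def by blast
  then have "map (\<lambda>l. ?s (map (\<lambda>r. r ! l) [x, y, z])) [0..<3] \<in> R"
    unfolding preserves_def using xyz by (elim allE[of _ "[x, y, z]"]) simp
  moreover have "map (\<lambda>l. ?s (map (\<lambda>r. r ! l) [x, y, z])) [0..<3] = combine x y z"
    unfolding combine_def by (rule map_cong[OF refl]) (use xyz R_nth in \<open>simp add: tuples_3\<close>)
  ultimately show ?thesis by simp
qed

definition flip :: "nat \<Rightarrow> nat \<Rightarrow> nat list \<Rightarrow> nat list" where
  "flip i j v = combine (t[i := a ! i]) (t[j := a ! j]) v"

lemma flip_mem: "i < 3 \<Longrightarrow> j < 3 \<Longrightarrow> v \<in> R \<Longrightarrow> flip i j v \<in> R"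
  unfolding flip_def by (intro combine_mem update_mem)

lemma flip_nth:
  assumes "i \<noteq> j" "l < 3"
  shows "flip i j v ! l = (if l = i \<or> l = j then s (t ! l) (a ! l) (v ! l) else v ! l)"
  using assms length_tuple[OF t_tuple] sym_minority_commute(1)[of c "t ! i" "a ! i"]
  by (auto simp: flip_def combine_nth nth_list_update)

lemma eq_tI: "v \<in> R \<Longrightarrow> (\<And>l. l < 3 \<Longrightarrow> v ! l = t ! l) \<Longrightarrow> v = t"
  using R_length[of v] length_tuple[OF t_tuple] by (simp add: list_eq_iff_nth_eq)

text \<open>The values \<^term>\<open>t ! l\<close> and \<^term>\<open>a ! l\<close> of the \<open>l\<close>-th coordinate represent 0 and 1. An element
  \<open>x\<close> is sent to one of them by \<open>s (t ! l) (a ! l)\<close>, which exchanges 0 and 1, unless \<open>x\<close> is \<^term>\<open>c\<close> and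
  differs from both; such an \<open>x\<close> counts as 1.\<close>

definition bit_at :: "nat \<Rightarrow> nat \<Rightarrow> bool" where
  "bit_at l x \<longleftrightarrow> s (t ! l) (a ! l) x \<noteq> a ! l"

definition wild :: "nat \<Rightarrow> nat \<Rightarrow> bool" where
  "wild l x \<longleftrightarrow> s (t ! l) (a ! l) x \<notin> {t ! l, a ! l}"

lemma s_wild:
  assumes "l < 3" "x \<in> A" "wild l x"
  shows "s (t ! l) (a ! l) x = x"
proof -
  have tl: "t ! l \<in> A" "a ! l \<in> A" using assms(1) t_tuple a_tuple tuples_nth by blast+
  have "x \<noteq> t ! l" "x \<noteq> a ! l" using assms(3) by (auto simp: wild_def)
  then show ?thesis
    using assms(2,3) tl unfolding wild_def carrier
    by (auto simp: sym_minority_def split: if_splits)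
qed

lemma wild_all_coordinates:
  assumes v: "v \<in> R" and i: "i < 3" "wild i (v ! i)" and j: "j < 3"
  shows "wild j (v ! j)"
proof (rule ccontr)
  assume not_wild: "\<not> wild j (v ! j)"
  then have ij: "i \<noteq> j" using i by blast
  let ?w = "combine (t[i := a ! i]) v (flip i j v)"
  have w: "?w \<in> R" using v i(1) j by (intro combine_mem update_mem flip_mem)
  have "flip i j ?w ! l = t ! l" if l: "l < 3" for l
  proof -
    consider (at_i) "l = i" | (at_j) "l = j" | (elsewhere) "l \<noteq> i" "l \<noteq> j" by blast
    then show ?thesis
    proof cases
      case at_i
      have "s (t ! i) (a ! i) (v ! i) = v ! i" using s_wild R_nth v i by blast
      then show ?thesis using at_i ij i(1) length_tuple[OF t_tuple] by (simp add: flip_nth combine_nth)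
    next
      case at_j
      have "s (t ! j) (a ! j) (v ! j) \<in> {t ! j, a ! j}" using not_wild by (simp add: wild_def)
      then have "s (t ! j) (a ! j) (s (t ! j) (v ! j) (s (t ! j) (a ! j) (v ! j))) = t ! j"
        using sym_minority_commute(2)[of c "t ! j" "a ! j" "v ! j"] by auto
      then show ?thesis using at_j ij j by (simp add: flip_nth combine_nth)
    next
      case elsewhere
      then show ?thesis using l ij by (simp add: flip_nth combine_nth)
    qed
  qed
  then show False using eq_tI[OF flip_mem[OF i(1) j w]] flip_mem[OF i(1) j w] t_notin by metis
qed

lemma s_eq_t_if_bit: "bit_at l x \<Longrightarrow> \<not> wild l x \<Longrightarrow> s (t ! l) (a ! l) x = t ! l"
  and s_eq_a_if_not_bit: "\<not> bit_at l x \<Longrightarrow> s (t ! l) (a ! l) x = a ! l"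
  and bit_if_wild: "wild l x \<Longrightarrow> bit_at l x"
  by (auto simp: bit_at_def wild_def)

lemma bit_exists:
  assumes v: "v \<in> R"
  shows "\<exists>l\<in>{0, 1, 2}. bit_at l (v ! l)"
proof (rule ccontr)
  assume "\<not> ?thesis"
  then have no_bit: "\<not> bit_at l (v ! l)" if "l \<in> {0, 1, 2}" for l using that by blast
  let ?w = "flip 0 1 (flip 0 2 (flip 1 2 v))"
  have "?w \<in> R" using v by (intro flip_mem) simp_all
  moreover have "?w ! l = t ! l" if "l < 3" for l
  proof -
    have "l \<in> {0, 1, 2}" using that by auto
    then show ?thesis using s_eq_a_if_not_bit[OF no_bit] that by (auto simp: flip_nth)
  qed
  ultimately show False using eq_tI t_notin by metis
qed

lemma third_bit:
  assumes v: "v \<in> R" and ijk: "[i, j, k] \<in> {[0, 1, 2], [0, 2, 1], [1, 2, 0]}"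
    and bits: "bit_at i (v ! i)" "bit_at j (v ! j)" and not_wild: "\<not> wild i (v ! i)" "\<not> wild j (v ! j)"
  shows "bit_at k (v ! k)"
proof (rule ccontr)
  assume not_bit: "\<not> bit_at k (v ! k)"
  let ?w = "flip i k (flip j k v)"
  have less: "i < 3" "j < 3" "k < 3" and neq: "i \<noteq> j" "i \<noteq> k" "j \<noteq> k" using ijk by auto
  then have "?w \<in> R" using v by (intro flip_mem)
  moreover have "?w ! l = t ! l" if "l < 3" for l
  proof -
    have "l = i \<or> l = j \<or> l = k" using ijk that by auto
    then show ?thesis
      using less neq s_eq_t_if_bit[OF bits(1) not_wild(1)] s_eq_t_if_bit[OF bits(2) not_wild(2)]
        s_eq_a_if_not_bit[OF not_bit]
      by (auto simp: flip_nth)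
  qed
  ultimately show False using eq_tI t_notin by metis
qed

lemma bits_odd:
  assumes v: "v \<in> R"
  shows "bit_at 0 (v ! 0) = (bit_at 1 (v ! 1) = bit_at 2 (v ! 2))"
proof (cases "\<exists>i<3. wild i (v ! i)")
  case True
  then have "bit_at l (v ! l)" if "l < 3" for l using wild_all_coordinates[OF v] bit_if_wild that by blast
  then show ?thesis by simp
next
  case False
  then have "\<not> wild 0 (v ! 0)" "\<not> wild 1 (v ! 1)" "\<not> wild 2 (v ! 2)" by auto
  then show ?thesis
    using bit_exists[OF v] third_bit[OF v, of 0 1 2] third_bit[OF v, of 0 2 1] third_bit[OF v, of 1 2 0]
    by auto
qed

definition digit :: "nat \<Rightarrow> nat \<Rightarrow> nat" where
  "digit l b = (if b = 0 then t ! l else a ! l)"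

definition to_Z2 :: "nat \<Rightarrow> (nat list \<Rightarrow> nat) \<Rightarrow> nat list \<Rightarrow> nat" where
  "to_Z2 = reflection {0, 1} [digit 0] (\<lambda>ys. of_bool (bit_at 0 (ys ! 0)))"

lemma digit_mem: "l < 3 \<Longrightarrow> digit l b \<in> A"
  using t_tuple a_tuple tuples_nth by (simp add: digit_def)

lemma bit_digit:
  assumes "l < 3"
  shows "bit_at l (digit l b) \<longleftrightarrow> b \<noteq> 0"
proof -
  have "t[l := a ! l] \<noteq> t" using update_mem[OF assms] t_notin by metis
  then have "t ! l \<noteq> a ! l" by (metis list_update_id)
  then show ?thesis by (simp add: bit_at_def digit_def)
qed

lemma digits_mem:
  assumes "x \<in> {0, 1}" "y \<in> {0, 1}" "z \<in> {0, 1}" "odd (x + y + z)"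
  shows "[digit 0 x, digit 1 y, digit 2 z] \<in> R"
proof -
  obtain t0 t1 t2 a0 a1 a2 where ta: "t = [t0, t1, t2]" "a = [a0, a1, a2]"
    using t_tuple a_tuple by (auto simp: tuples_3)
  have units: "[a0, t1, t2] \<in> R" "[t0, a1, t2] \<in> R" "[t0, t1, a2] \<in> R"
    using update_mem[of 0] update_mem[of 1] update_mem[of 2] by (simp_all add: ta)
  have "[a0, a1, a2] \<in> R"
    using combine_mem[OF units] by (simp add: combine_def upt_rec)
  with units show ?thesis using assms unfolding digit_def by (auto simp: ta)
qed

lemma to_Z2_mem:
  assumes f: "(n, f) \<in> C"
  shows "(n, to_Z2 n f) \<in> Z2"
proof -
  define component where "component l x = (of_bool (bit_at l (f (map (digit l) x))) :: nat)" for l x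
  have to_Z2: "to_Z2 n f x = component 0 x" if "x \<in> tuples {0, 1} n" for x
    using that by (simp add: to_Z2_def reflection_def component_def)
  have component_replicate: "component l (replicate n b) = b" if "l < 3" "b \<in> {0, 1}" for l b
    using that mem_idempotent[OF f digit_mem[OF that(1)]] bit_digit[OF that(1)]
    by (auto simp: component_def)
  show ?thesis
  proof (rule Z2_if_odd_sums[where g = "component 1" and h = "component 2"])
    show "1 \<le> n" using f by (rule mem_arity_pos)
    show "to_Z2 n f \<in> ops {0, 1} n" by (auto simp: to_Z2_def reflection_def ops_def)
    show "to_Z2 n f (replicate n 0) = 0" "to_Z2 n f (replicate n 1) = 1" "component 1 (replicate n 0) = 0"
      using component_replicate to_Z2 replicate_in_tuples[of _ "{0, 1}" n] by simp_all
    fix x y z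
    assume xyz: "x \<in> tuples {0, 1} n" "y \<in> tuples {0, 1} n" "z \<in> tuples {0, 1} n"
      and odd: "\<And>i. i < n \<Longrightarrow> odd (x ! i + y ! i + z ! i)"
    have "[f (map (digit 0) x), f (map (digit 1) y), f (map (digit 2) z)] \<in> R"
    proof (rule R_columns[OF f])
      fix i assume i: "i < n"
      then have "[digit 0 (x ! i), digit 1 (y ! i), digit 2 (z ! i)] \<in> R"
        using xyz tuples_nth odd by (intro digits_mem) blast+
      then show "[map (digit 0) x ! i, map (digit 1) y ! i, map (digit 2) z ! i] \<in> R"
        using i xyz length_tuple by simp
    qed (use xyz length_tuple in auto)
    then show "odd (to_Z2 n f x + component 1 y + component 2 z)"
      using bits_odd to_Z2[OF xyz(1)] by (fastforce simp: component_def)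
  qed
qed

lemma minion_hom_to_Z2: "minion_hom A C {0, 1} Z2 to_Z2"
  unfolding to_Z2_def
  by (rule minion_hom_reflection; (erule to_Z2_mem[unfolded to_Z2_def])?) (auto intro: digit_mem)

end

theorem theorem7p4:
  fixes C :: "(nat \<times> (nat list \<Rightarrow> nat)) set"
  assumes "is_clone {0, 1, 2} C"
    and "idempotent_clone {0, 1, 2} C"
    and "malcev_clone {0, 1, 2} C"
    and "\<not> has_majority {0, 1, 2} C"
    and "\<not> clone_preserves C 2 phi"
  shows "minion_equiv {0, 1, 2} C {0, 1} Z2"
proof -
  interpret idempotent_clone_three "{0, 1, 2}" C
    using assms(1,2) by unfold_locales simp_all
  obtain d where "malcev_op d" using malcev_op_exists[OF assms(3)] .
  moreover obtain g where g: "breaks_cycle g" using breaks_cycle_exists[OF assms(5)] .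
  ultimately obtain m where "is_minority m" by (rule minority_exists)
  then obtain c where c: "c \<in> {0, 1, 2}" "ternary (sym_minority c)"
    using g by (rule sym_minority_exists)
  obtain p where p: "p \<in> {0, 1, 2}" "p \<noteq> c" using third_element by metis
  obtain q where q: "q \<in> {0, 1, 2}" "q \<noteq> c" "q \<noteq> p" using third_element .
  interpret sym_minority_clone "{0, 1, 2}" C p q c
    using three_elements_exhaust[of p q c] c p q by unfold_locales auto
  obtain R t a where "separating_relation R t a"
    using no_majority_relation[OF _ assms(4)] by blast
  then interpret parity_relation "{0, 1, 2}" C p q c R t a
    by unfold_locales
  show ?thesis
    unfolding minion_equiv_def using minion_hom_to_Z2 minion_hom_from_Z2 by blast
qed

end
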